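(* Let $G$ be a graph with exactly $h$ holes such that for any two distinct holes $C_1$ and $C_2$ of $G$, $|E(C_1) \cap E(C_2)| \leq 1$. Then the competition number of $G$ satisfies $k(G) \le h+1$.
   Context: Graphs are finite, simple and undirected. A hole of a graph $G$ is a cycle of length at least $4$ that is an induced subgraph of $G$. The competition graph $C(D)$ of an acyclic digraph $D$ is the graph with vertex set $V(D)$ in which two distinct vertices $x,y$ are adjacent if and only if there is a vertex $v$ of $D$ such that $(x,v)$ and $(y,v)$ are arcs of $D$. The competition number $k(G)$ of a graph $G$ is the smallest nonnegative integer $k$ such that the disjoint union of $G$ with $k$ isolated vertices is the competition graph of some acyclic digraph. *)

theory Defs
  imports "Graph_Theory.Digraph_Component"
begin

text \<open>
  A finite simple undirected graph is a \<^term>\<open>pair_graph\<close>: a finite, loop-free, symmetric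
  digraph without parallel arcs, so that every undirected edge is represented by its two
  orientations.
\<close>

definition edges :: "'a pair_pre_digraph \<Rightarrow> 'a set set" where
  "edges G = {{u, v} | u v. (u, v) \<in> parcs G}"

text \<open>The undirected subgraph traced out by the arc list of a cycle.\<close>

definition cycle_graph :: "('a \<times> 'a) list \<Rightarrow> 'a pair_pre_digraph" where
  "cycle_graph p = \<lparr>pverts = fst ` set p, parcs = set p \<union> (set p)\<inverse>\<rparr>"

text \<open>
  Holes are subgraphs rather than arc lists, so that a hole is counted once and not once for
  every starting vertex and orientation. The bound \<open>4 \<le> length p\<close> also rules out the
  degenerate closed walks \<open>a, b, a\<close>, which the library accepts as cycles.
\<close>

definition hole :: "'a pair_pre_digraph \<Rightarrow> 'a pair_pre_digraph \<Rightarrow> bool" where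
  "hole G C \<longleftrightarrow>
     (\<exists>p. pre_digraph.cycle (with_proj G) p \<and> 4 \<le> length p \<and> C = cycle_graph p) \<and>
     induced_subgraph (with_proj C) (with_proj G)"

definition competition_graph :: "'a pair_pre_digraph \<Rightarrow> 'a pair_pre_digraph" where
  "competition_graph D =
     \<lparr>pverts = pverts D,
      parcs = {(x, y). x \<in> pverts D \<and> y \<in> pverts D \<and> x \<noteq> y \<and>
                 (\<exists>v\<in>pverts D. (x, v) \<in> parcs D \<and> (y, v) \<in> parcs D)}\<rparr>"

text \<open>
  The sum type makes the union disjoint and provides enough new vertices even when \<open>'a\<close> is
  finite.
\<close>

definition add_isolated :: "'a pair_pre_digraph \<Rightarrow> nat \<Rightarrow> ('a + nat) pair_pre_digraph" where
  "add_isolated G k =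
     \<lparr>pverts = Inl ` pverts G \<union> Inr ` {..<k},
      parcs = map_prod Inl Inl ` parcs G\<rparr>"

text \<open>
  Competition graphs are compared by equality, not isomorphism: the vertices of the acyclic
  digraph can be renamed, so this makes no difference.
\<close>

definition competition_number :: "'a pair_pre_digraph \<Rightarrow> nat" where
  "competition_number G =
     (LEAST k. \<exists>D. pair_digraph D \<and> acyclic (parcs D) \<and>
        competition_graph D = add_isolated G k)"

lemma finite_holes:
  assumes "pair_graph G"
  shows "finite {C. hole G C}"
proof -
  interpret pair_graph G by (rule assms)
  let ?f = "\<lambda>C::'a pair_pre_digraph. (pverts C, parcs C)"
  have "?f ` {C. hole G C} \<subseteq> Pow (pverts G) \<times> Pow (parcs G)"
    by (auto simp: hole_def induced_subgraph_def subgraph_def)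
  moreover have "finite (Pow (pverts G) \<times> Pow (parcs G))"
    using pair_finite_verts pair_finite_arcs by simp
  ultimately have "finite (?f ` {C. hole G C})"
    by (rule finite_subset)
  moreover have "inj_on ?f {C. hole G C}"
    by (rule inj_onI) (auto intro: pair_pre_digraph.equality)
  ultimately show ?thesis
    by (rule finite_imageD)
qed

text \<open>
  The minimum in the definition of the competition number is attained: one new vertex per
  edge, serving as common prey of the two ends of that edge, always suffices.
\<close>

lemma competition_number_exists:
  fixes G :: "'a pair_pre_digraph"
  assumes "pair_graph G"
  shows "\<exists>k D. pair_digraph D \<and> acyclic (parcs D) \<and>
           competition_graph D = add_isolated G k"
proof -
  interpret pair_graph G by (rule assms)
  obtain k f where f: "bij_betw f {..<k::nat} (parcs G)"
    using pair_finite_arcs by (metis ex_bij_betw_nat_finite atLeast0LessThan)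
  define A :: "('a + nat) rel" where
    "A = (\<Union>i\<in>{..<k}. {(Inl (fst (f i)), Inr i), (Inl (snd (f i)), Inr i)})"
  define D where "D = \<lparr>pverts = Inl ` pverts G \<union> Inr ` {..<k}, parcs = A\<rparr>"
  have fG: "f i \<in> parcs G" if "i < k" for i
    using f that by (auto simp: bij_betw_def)
  have "pair_digraph D"
  proof
    show "fst e \<in> pverts D" "snd e \<in> pverts D" if "e \<in> parcs D" for e
      using that fG arc_fst_in_verts arc_snd_in_verts
      by (auto simp: D_def A_def)
    show "finite (pverts D)" "finite (parcs D)"
      using pair_finite_verts by (auto simp: D_def A_def)
    show "fst e \<noteq> snd e" if "e \<in> parcs D" for e
      using that by (auto simp: D_def A_def)
  qed
  moreover have "acyclic (parcs D)"
  proof (rule acyclicI_order)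
    show "(case b of Inl _ \<Rightarrow> 1 | Inr _ \<Rightarrow> 0) < (case a of Inl _ \<Rightarrow> 1 | Inr _ \<Rightarrow> (0::nat))"
      if "(a, b) \<in> parcs D" for a b
      using that by (auto simp: D_def A_def)
  qed
  moreover have "competition_graph D = add_isolated G k"
  proof -
    have "(x, y) \<in> map_prod Inl Inl ` parcs G \<longleftrightarrow>
       x \<noteq> y \<and> (\<exists>v. (x, v) \<in> A \<and> (y, v) \<in> A)" (is "?L \<longleftrightarrow> ?R") for x y
    proof
      assume ?L
      then obtain a b where ab: "x = Inl a" "y = Inl b" "(a, b) \<in> parcs G"
        by auto
      then obtain i where i: "i < k" "f i = (a, b)"
        using f by (metis bij_betw_imp_surj_on imageE lessThan_iff)
      have "(x, Inr i) \<in> A" "(y, Inr i) \<in> A"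
        unfolding A_def using i ab by force+
      moreover have "a \<noteq> b"
        using pair_no_loops[OF ab(3)] by simp
      ultimately show ?R
        using ab by auto
    next
      assume ?R
      then obtain i where i: "i < k" "x \<noteq> y"
        "x \<in> {Inl (fst (f i)), Inl (snd (f i))}" "y \<in> {Inl (fst (f i)), Inl (snd (f i))}"
        by (auto simp: A_def)
      have "(fst (f i), snd (f i)) \<in> parcs G" "(snd (f i), fst (f i)) \<in> parcs G"
        using fG[OF i(1)] arcs_symmetric by auto
      then show ?L
        using i by (elim insertE emptyE) (auto intro: rev_image_eqI)
    qed
    moreover have "x \<in> pverts D \<and> v \<in> pverts D" if "(x, v) \<in> A" for x v
      using that fG arc_fst_in_verts arc_snd_in_verts by (auto simp: D_def A_def)
    ultimately have "{(x, y). x \<in> pverts D \<and> y \<in> pverts D \<and> x \<noteq> y \<and>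
                 (\<exists>v\<in>pverts D. (x, v) \<in> A \<and> (y, v) \<in> A)} = map_prod Inl Inl ` parcs G"
      by (intro set_eqI) (clarsimp, blast)
    then show ?thesis
      by (simp add: competition_graph_def add_isolated_def D_def)
  qed
  ultimately show ?thesis
    by blast
qed

end

theory Submission
  imports Defs "Graph_Theory.Vertex_Walk"
begin

text \<open>
  The proof eliminates the vertices of \<open>G\<close> one at a time, choosing each one so that it pays
  for itself with holes. Call a vertex \<open>v\<close> avoidable if any two nonadjacent neighbours \<open>u\<close>, \<open>w\<close>
  of \<open>v\<close> are joined by a path whose inner vertices avoid \<open>v\<close> and its neighbours. An induced
  such path closes up through \<open>v\<close> to a hole in which the neighbours of \<open>v\<close> are precisely
  \<open>u\<close> and \<open>w\<close>. Distinct nonadjacent pairs thus yield distinct holes, so \<open>v\<close> lies on at least as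
  many holes as its neighbourhood has nonadjacent pairs (\<open>card_nonadjacent_le_holes\<close>). Every
  nonempty finite graph has an avoidable vertex (\<open>avoidable_exists\<close>); this generalises the
  existence of a simplicial vertex in a chordal graph.

  If the neighbourhood of \<open>v\<close> has \<open>m\<close> nonadjacent pairs, then \<open>m + 1\<close> cliques cover all edges at
  \<open>v\<close> (\<open>clique_cover_nonadjacent\<close>): choose one vertex from each pair, use the edge from \<open>v\<close> to
  each chosen vertex, and note that the other neighbours form a clique. Deleting \<open>v\<close> destroys at
  least \<open>m\<close> holes, so by induction the edges of \<open>G\<close> are covered by at most \<open>n + h + 1\<close> cliques,
  where \<open>n\<close> is the number of vertices (\<open>clique_schedule_exists\<close>). The elimination order also
  arranges these cliques so that the clique at position \<open>i\<close> uses only vertices at positions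
  before \<open>i\<close>. Hence the \<open>i\<close>-th vertex can be the common prey of the \<open>i\<close>-th clique without
  creating a directed cycle, and only the cliques beyond the first \<open>n\<close>, at most \<open>h + 1\<close> of them,
  need a new isolated vertex as prey (\<open>competition_number_le_schedule\<close>).
\<close>

section \<open>Avoidable vertices\<close>

text \<open>
  The vertices \<open>W\<close> stand for the induced subgraph in which avoidability is meant: the induction
  below passes to induced subgraphs, while the edge relation \<open>E\<close> stays fixed.
\<close>

definition avoidable :: "'a rel \<Rightarrow> 'a set \<Rightarrow> 'a \<Rightarrow> bool" where
  "avoidable E W v \<longleftrightarrow> v \<in> W \<and>
     (\<forall>u\<in>W. \<forall>w\<in>W. (v, u) \<in> E \<longrightarrow> (v, w) \<in> E \<longrightarrow> u \<noteq> w \<longrightarrow> (u, w) \<notin> E \<longrightarrow>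
        (u, w) \<in> (Restr E ({u, w} \<union> (W - ({v} \<union> E `` {v}))))\<^sup>*)"

lemma rtrancl_Restr_mono:
  assumes "(u, w) \<in> (Restr E X)\<^sup>*" "X \<subseteq> Y"
  shows "(u, w) \<in> (Restr E Y)\<^sup>*"
  using assms rtrancl_mono[of "Restr E X" "Restr E Y"] by blast

definition connected_in :: "'a rel \<Rightarrow> 'a set \<Rightarrow> bool" where
  "connected_in E C \<longleftrightarrow> (\<forall>x\<in>C. \<forall>y\<in>C. (x, y) \<in> (Restr E C)\<^sup>*)"

lemma connected_in_insert:
  assumes "sym E" "connected_in E C" "a \<in> C" "(a, s) \<in> E"
  shows "connected_in E (insert s C)"
  unfolding connected_in_def
proof (intro ballI)
  let ?R = "Restr E (insert s C)"
  have a: "(x, a) \<in> ?R\<^sup>* \<and> (a, x) \<in> ?R\<^sup>*" if "x \<in> insert s C" for x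
  proof (cases "x = s")
    case True
    moreover have "(a, s) \<in> ?R" "(s, a) \<in> ?R"
      using assms by (auto dest: symD)
    ultimately show ?thesis by blast
  next
    case False
    then have "x \<in> C" using that by simp
    then have "(x, a) \<in> (Restr E C)\<^sup>*" and "(a, x) \<in> (Restr E C)\<^sup>*"
      using assms(2,3) by (auto simp: connected_in_def)
    from this[THEN rtrancl_Restr_mono, OF subset_insertI] show ?thesis ..
  qed
  fix x y assume "x \<in> insert s C" "y \<in> insert s C"
  then show "(x, y) \<in> ?R\<^sup>*"
    using a by (meson rtrancl_trans)
qed

text \<open>
  Take a maximal connected set \<open>C\<close> that does not dominate \<open>W\<close>, and let \<open>R\<close> be the nonempty set of
  vertices that are neither in \<open>C\<close> nor adjacent to it. Adding to \<open>C\<close> a neighbour \<open>s\<close> of \<open>C\<close> keeps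
  it connected, so by maximality \<open>s\<close> is adjacent to all of \<open>R\<close>. A vertex \<open>v\<close> that is avoidable in
  \<open>R\<close> is then avoidable in \<open>W\<close>: its neighbours lie in \<open>R\<close> or are neighbours of \<open>C\<close>, two of the
  latter are joined through \<open>C\<close>, and a mixed pair is adjacent. If there is no such \<open>C\<close>, then every
  single vertex dominates \<open>W\<close>, which is therefore complete.
\<close>

lemma avoidable_exists:
  assumes "finite W" "W \<noteq> {}" "sym E"
  shows "\<exists>v. avoidable E W v"
  using assms(1,2)
proof (induction W rule: finite_psubset_induct)
  case (psubset W)
  define F where "F = {C. C \<subseteq> W \<and> C \<noteq> {} \<and> connected_in E C \<and> \<not> W \<subseteq> C \<union> E `` C}"
  show ?case
  proof (cases "F = {}")
    case True
    \<comment> \<open>a single vertex is connected, so it must dominate \<open>W\<close>\<close>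
    have complete: "(u, w) \<in> E" if "u \<in> W" "w \<in> W" "u \<noteq> w" for u w
    proof -
      have "connected_in E {u}" by (simp add: connected_in_def)
      then have "W \<subseteq> {u} \<union> E `` {u}"
        using True that unfolding F_def by blast
      then show ?thesis using that by blast
    qed
    from psubset.prems obtain v where "v \<in> W" by blast
    then have "avoidable E W v"
      using complete by (auto simp: avoidable_def)
    then show ?thesis ..
  next
    case False
    have "finite F"
      by (rule finite_subset[of _ "Pow W"]) (use psubset.hyps in \<open>auto simp: F_def\<close>)
    then obtain C where C: "C \<in> F" and C_max: "\<And>B. B \<in> F \<Longrightarrow> C \<subseteq> B \<Longrightarrow> B = C"
      using finite_has_maximal[of F] False by metis
    then have CW: "C \<subseteq> W" "C \<noteq> {}" "connected_in E C" "\<not> W \<subseteq> C \<union> E `` C"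
      by (auto simp: F_def)
    define R where "R = W - (C \<union> E `` C)"
    have "R \<subset> W" "R \<noteq> {}"
      using CW by (auto simp: R_def)
    then obtain v where v: "avoidable E R v"
      using psubset.IH by blast
    then have vR: "v \<in> R" by (simp add: avoidable_def)
    have joined: "(s, r) \<in> E" if s: "s \<in> W" "s \<notin> C" "s \<in> E `` C" and r: "r \<in> R" for s r
    proof -
      obtain a where "a \<in> C" "(a, s) \<in> E" using s by blast
      then have "connected_in E (insert s C)"
        using CW assms(3) connected_in_insert by metis
      moreover have "insert s C \<notin> F"
        using C_max[of "insert s C"] s by blast
      ultimately have "W \<subseteq> insert s C \<union> E `` insert s C"
        using CW s by (auto simp: F_def)
      then show ?thesis
        using r s by (auto simp: R_def)
    qed
    have away: "C \<subseteq> W - ({v} \<union> E `` {v})"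
      using CW vR assms(3) by (auto simp: R_def dest: symD)
    have "avoidable E W v"
      unfolding avoidable_def
    proof (intro conjI ballI impI)
      show "v \<in> W" using vR by (simp add: R_def)
    next
      fix u w
      assume uw: "u \<in> W" "w \<in> W" "(v, u) \<in> E" "(v, w) \<in> E" "u \<noteq> w" "(u, w) \<notin> E"
      let ?X = "{u, w} \<union> (W - ({v} \<union> E `` {v}))"
      have "u \<notin> C" "w \<notin> C" using away uw by auto
      then consider "u \<in> E `` C" "w \<in> E `` C" | "u \<in> E `` C" "w \<in> R"
        | "u \<in> R" "w \<in> E `` C" | "u \<in> R" "w \<in> R"
        using uw by (auto simp: R_def)
      then show "(u, w) \<in> (Restr E ?X)\<^sup>*"
      proof cases
        case 1
        then obtain a b where ab: "a \<in> C" "(a, u) \<in> E" "b \<in> C" "(b, w) \<in> E"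
          by blast
        have "(a, b) \<in> (Restr E C)\<^sup>*"
          using CW ab by (simp add: connected_in_def)
        then have ab_path: "(a, b) \<in> (Restr E ?X)\<^sup>*"
          by (rule rtrancl_Restr_mono) (use away in blast)
        have "(u, a) \<in> E" using ab assms(3) by (blast dest: symD)
        then have "(u, a) \<in> Restr E ?X" "(b, w) \<in> Restr E ?X"
          using ab away by blast+
        then show ?thesis
          using ab_path by (blast intro: converse_rtrancl_into_rtrancl rtrancl_into_rtrancl)
      next
        case 2
        then show ?thesis using joined[of u w] uw \<open>u \<notin> C\<close> by blast
      next
        case 3
        then show ?thesis using joined[of w u] uw \<open>w \<notin> C\<close> assms(3) by (meson symD)
      next
        case 4
        then have "(u, w) \<in> (Restr E ({u, w} \<union> (R - ({v} \<union> E `` {v}))))\<^sup>*"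
          using v uw by (simp add: avoidable_def)
        then show ?thesis
          by (rule rtrancl_Restr_mono) (auto simp: R_def)
      qed
    qed
    then show ?thesis ..
  qed
qed

section \<open>Holes from induced paths\<close>

fun induced_path :: "'a rel \<Rightarrow> 'a list \<Rightarrow> bool" where
  "induced_path E [] \<longleftrightarrow> False"
| "induced_path E [x] \<longleftrightarrow> True"
| "induced_path E (x # y # ys) \<longleftrightarrow> (x, y) \<in> E \<and> x \<notin> set (y # ys) \<and>
     (\<forall>z\<in>set ys. (x, z) \<notin> E) \<and> induced_path E (y # ys)"

lemma induced_path_suffix:
  "induced_path E (xs @ ys) \<Longrightarrow> ys \<noteq> [] \<Longrightarrow> induced_path E ys"
proof (induction xs)
  case (Cons x xs)
  then show ?case by (cases "xs @ ys") auto
qed simp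

lemma induced_path_distinct: "induced_path E xs \<Longrightarrow> distinct xs"
  by (induction E xs rule: induced_path.induct) auto

text \<open>
  Prepending a new first vertex \<open>u\<close> to an induced path requires a jump to the last vertex of the
  path that is adjacent to \<open>u\<close>. What remains is an induced path again, since suffixes of induced
  paths are induced.
\<close>

lemma induced_path_exists:
  assumes "(u, w) \<in> (Restr E X)\<^sup>*" "w \<in> X"
  shows "\<exists>xs. induced_path E xs \<and> hd xs = u \<and> last xs = w \<and> set xs \<subseteq> X"
  using assms(1)
proof (induction rule: converse_rtrancl_induct)
  case base
  then show ?case using assms(2) by (intro exI[of _ "[w]"]) simp
next
  case (step u t)
  then obtain xs where xs: "induced_path E xs" "hd xs = t" "last xs = w" "set xs \<subseteq> X"
    by blast
  then have "t \<in> set xs" by (cases xs) auto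
  show ?case
  proof (cases "u \<in> set xs")
    case True
    then obtain ys zs where "xs = ys @ u # zs" by (meson split_list)
    then show ?thesis
      using xs induced_path_suffix[of E ys "u # zs"] by (intro exI[of _ "u # zs"]) auto
  next
    case False
    have "\<exists>x\<in>set xs. (u, x) \<in> E" using step \<open>t \<in> set xs\<close> by blast
    then obtain ys z zs where z: "xs = ys @ z # zs" "(u, z) \<in> E" "\<forall>x\<in>set zs. (u, x) \<notin> E"
      by (rule split_list_last_propE)
    then show ?thesis
      using xs step False induced_path_suffix[of E ys "z # zs"]
      by (intro exI[of _ "u # z # zs"]) auto
  qed
qed

lemma induced_path_arcs:
  assumes "sym E" "irrefl E" "induced_path E xs"
  shows "Restr E (set xs) = set (vwalk_arcs xs) \<union> (set (vwalk_arcs xs))\<inverse>"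
  using assms(3)
proof (induction xs rule: vwalk_arcs.induct)
  case (2 x)
  then show ?case using assms(2) by (auto simp: irrefl_def)
next
  case (3 x y ys)
  have "Restr E (set (x # y # ys)) = {(x, y), (y, x)} \<union> Restr E (set (y # ys))"
    using 3 assms(1,2) by (auto simp: irrefl_def dest: symD)
  then show ?case using 3 by auto
qed simp

lemma pcas_vwalk_arcs: "xs \<noteq> [] \<Longrightarrow> pcas (hd xs) (vwalk_arcs xs) (last xs)"
  by (induction xs rule: vwalk_arcs.induct) auto

lemma pawalk_verts_vwalk_arcs: "xs \<noteq> [] \<Longrightarrow> pawalk_verts (hd xs) (vwalk_arcs xs) = xs"
  by (induction xs rule: vwalk_arcs.induct) auto

lemma fst_set_vwalk_arcs: "fst ` set (vwalk_arcs (xs @ [x])) = set xs"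
proof (induction xs)
  case (Cons a xs)
  then show ?case by (cases xs) auto
qed simp

lemma (in pair_graph) sym_parcs: "sym (parcs G)"
  using arcs_symmetric by (auto intro: symI)

lemma (in pair_graph) irrefl_parcs: "irrefl (parcs G)"
  using pair_no_loops by (fastforce simp: irrefl_def)

text \<open>
  As \<open>u\<close> and \<open>w\<close> are distinct and not adjacent, the path has at least three vertices, and so the
  cycle closed up through \<open>v\<close> has length at least four. It has no chords, because the path has
  none and \<open>v\<close> sees only the two ends.
\<close>

lemma (in pair_graph) hole_through_induced_path:
  assumes xs: "induced_path (parcs G) xs" "hd xs = u" "last xs = w" "set xs \<subseteq> pverts G"
    and uw: "u \<noteq> w" "(u, w) \<notin> parcs G"
    and v: "v \<in> pverts G" "v \<notin> set xs" "parcs G `` {v} \<inter> set xs = {u, w}"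
  shows "\<exists>C. hole G C \<and> pverts C = insert v (set xs)"
proof -
  define p where "p = vwalk_arcs (v # xs @ [v])"
  let ?C = "cycle_graph p"
  obtain y ys where "xs = u # y # ys" "ys \<noteq> []"
    using xs uw by (cases xs rule: vwalk_arcs.cases) (auto split: if_splits)
  then have len: "xs \<noteq> []" "3 \<le> length xs"
    by (auto simp: Suc_le_eq neq_Nil_conv)
  have set_p: "set p = insert (v, u) (insert (w, v) (set (vwalk_arcs xs)))"
    using len xs by (simp add: p_def vwalk_arcs_append)
  have verts: "pverts ?C = insert v (set xs)"
    using fst_set_vwalk_arcs[of "v # xs" v] by (simp add: cycle_graph_def p_def)
  have "parcs ?C = {(v, u), (u, v), (v, w), (w, v)} \<union> Restr (parcs G) (set xs)"
    unfolding induced_path_arcs[OF sym_parcs irrefl_parcs xs(1)] cycle_graph_def set_p by auto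
  also have "\<dots> = Restr (parcs G) (insert v (set xs))"
  proof -
    have "(v, v) \<notin> parcs G" using pair_no_loops by fastforce
    moreover have "u \<in> set xs" "w \<in> set xs" using xs len by auto
    moreover have "(v, x) \<in> parcs G \<longleftrightarrow> x = u \<or> x = w" "(x, v) \<in> parcs G \<longleftrightarrow> x = u \<or> x = w"
      if "x \<in> set xs" for x
      using v(3) that sym_parcs by (auto dest: symD)
    ultimately show ?thesis by auto
  qed
  finally have arcs: "parcs ?C = Restr (parcs G) (insert v (set xs))" .
  have "cycle p"
    unfolding cycle_def awalk_def
  proof (intro exI conjI)
    show "set p \<subseteq> parcs G"
      using arcs by (auto simp: cycle_graph_def)
    show "pcas v p v"
      using pcas_vwalk_arcs[of "v # xs @ [v]"] by (simp add: p_def)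
    show "distinct (tl (pawalk_verts v p))"
      using pawalk_verts_vwalk_arcs[of "v # xs @ [v]"] induced_path_distinct[OF xs(1)] v
      by (simp add: p_def)
    show "p \<noteq> []" by (simp add: p_def)
  qed (fact v(1))
  moreover have "length p \<ge> 4"
    unfolding p_def vwalk_length_def[symmetric] using len by simp
  moreover have "induced_subgraph (with_proj ?C) (with_proj G)"
  proof -
    have "wf_digraph (with_proj ?C)"
      by unfold_locales (auto simp: arcs verts)
    moreover have "pverts ?C \<subseteq> pverts G"
      using v(1) xs(4) verts by simp
    moreover have "parcs ?C = {e \<in> parcs G. fst e \<in> pverts ?C \<and> snd e \<in> pverts ?C}"
      unfolding arcs verts by auto
    ultimately show ?thesis
      unfolding induced_subgraph_def subgraph_def with_proj_simps
      using wf_digraph_axioms compatibleI_with_proj by blast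
  qed
  ultimately have "hole G ?C"
    unfolding hole_def by blast
  then show ?thesis using verts by blast
qed

text \<open>
  The last conjunct makes the pair \<open>{u, w}\<close> recoverable from the hole. This is what lets
  nonadjacent pairs be counted by holes.
\<close>

lemma (in pair_graph) avoidable_hole:
  assumes W: "W \<subseteq> pverts G" and v: "avoidable (parcs G) W v"
    and u: "u \<in> W" "(v, u) \<in> parcs G" and w: "w \<in> W" "(v, w) \<in> parcs G"
    and uw: "u \<noteq> w" "(u, w) \<notin> parcs G"
  shows "\<exists>C. hole G C \<and> pverts C \<subseteq> W \<and> v \<in> pverts C \<and> parcs G `` {v} \<inter> pverts C = {u, w}"
proof -
  let ?X = "{u, w} \<union> (W - ({v} \<union> parcs G `` {v}))"
  have loop: "(v, v) \<notin> parcs G" using pair_no_loops by fastforce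
  have "(u, w) \<in> (Restr (parcs G) ?X)\<^sup>*"
    using v u w uw by (simp add: avoidable_def)
  then obtain xs where xs: "induced_path (parcs G) xs" "hd xs = u" "last xs = w" "set xs \<subseteq> ?X"
    using induced_path_exists[of u w "parcs G" ?X] by auto
  then have "xs \<noteq> []" by auto
  then have "u \<in> set xs" "w \<in> set xs" using xs by auto
  then have N: "parcs G `` {v} \<inter> set xs = {u, w}"
    using xs(4) u w by auto
  have vW: "v \<in> W" using v by (simp add: avoidable_def)
  have "v \<notin> set xs" using xs(4) u w loop by auto
  moreover have "set xs \<subseteq> W" using xs(4) u w by auto
  ultimately obtain C where "hole G C" "pverts C = insert v (set xs)"
    using hole_through_induced_path[OF xs(1-3) _ uw _ _ N] W vW by blast
  moreover have "parcs G `` {v} \<inter> insert v (set xs) = {u, w}"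
    using N loop by auto
  ultimately show ?thesis
    using \<open>set xs \<subseteq> W\<close> vW by (intro exI[of _ C]) simp
qed

section \<open>Elimination orderings\<close>

definition is_clique :: "'a rel \<Rightarrow> 'a set \<Rightarrow> bool" where
  "is_clique E S \<longleftrightarrow> (\<forall>x\<in>S. \<forall>y\<in>S. x \<noteq> y \<longrightarrow> (x, y) \<in> E)"

text \<open>
  The vertices are listed in reverse order of elimination. Clique \<open>i\<close> of the cover may use
  only the vertices listed before position \<open>i\<close>, so that the vertex at position \<open>i\<close>, or a new one
  if the list is exhausted, can serve as its prey.
\<close>

definition clique_schedule :: "'a rel \<Rightarrow> 'a set \<Rightarrow> 'a list \<Rightarrow> 'a set list \<Rightarrow> bool" where
  "clique_schedule E W vs Ss \<longleftrightarrow> distinct vs \<and> set vs = W \<and>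
     (\<forall>i<length Ss. Ss ! i \<subseteq> set (take i vs)) \<and>
     (\<forall>S\<in>set Ss. is_clique E S) \<and>
     (\<forall>(x, y)\<in>Restr E W. \<exists>S\<in>set Ss. x \<in> S \<and> y \<in> S)"

lemma clique_scheduleD:
  assumes "clique_schedule E W vs Ss"
  shows "distinct vs" and "set vs = W"
    and "\<And>i. i < length Ss \<Longrightarrow> Ss ! i \<subseteq> set (take i vs)"
    and "\<And>S. S \<in> set Ss \<Longrightarrow> is_clique E S"
    and "\<And>x y. (x, y) \<in> E \<Longrightarrow> x \<in> W \<Longrightarrow> y \<in> W \<Longrightarrow> \<exists>S\<in>set Ss. x \<in> S \<and> y \<in> S"
proof -
  note sched = assms[unfolded clique_schedule_def]
  note rest = sched[THEN conjunct2, THEN conjunct2]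
  show "distinct vs" "set vs = W"
    using sched by simp_all
  show "Ss ! i \<subseteq> set (take i vs)" if "i < length Ss" for i
    using rest[THEN conjunct1] that by simp
  show "is_clique E S" if "S \<in> set Ss" for S
    using rest[THEN conjunct2, THEN conjunct1] that by simp
  show "\<exists>S\<in>set Ss. x \<in> S \<and> y \<in> S" if "(x, y) \<in> E" "x \<in> W" "y \<in> W" for x y
    using rest[THEN conjunct2, THEN conjunct2, THEN bspec, of "(x, y)"] that by simp
qed

text \<open>
  One vertex is chosen from each nonadjacent pair. Each chosen vertex gets an edge of its own, and
  the vertices that are left over contain no nonadjacent pair.
\<close>

lemma clique_cover_nonadjacent:
  assumes "finite N" "\<forall>u\<in>N. (v, u) \<in> E" "sym E"
    and M: "M = {{u, w} | u w. u \<in> N \<and> w \<in> N \<and> u \<noteq> w \<and> (u, w) \<notin> E}"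
  shows "\<exists>Ts. Ts \<noteq> [] \<and> length Ts \<le> card M + 1 \<and>
    (\<forall>T\<in>set Ts. T \<subseteq> insert v N \<and> is_clique E T) \<and>
    (\<forall>u\<in>N. \<exists>T\<in>set Ts. v \<in> T \<and> u \<in> T)"
proof -
  define B where "B = (\<lambda>X. SOME x. x \<in> X) ` M"
  have pick: "(SOME x. x \<in> X) \<in> X" if "X \<in> M" for X
    using that by (auto simp: M some_in_eq)
  have "M \<subseteq> Pow N" by (auto simp: M)
  then have finM: "finite M" using assms(1) finite_subset by blast
  then have "finite B" "card B \<le> card M"
    by (auto simp: B_def card_image_le)
  have BN: "B \<subseteq> N" using pick \<open>M \<subseteq> Pow N\<close> by (auto simp: B_def)
  obtain bs where bs: "set bs = B" "length bs = card B"
    using \<open>finite B\<close> by (metis distinct_card finite_distinct_list)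
  let ?Ts = "insert v (N - B) # map (\<lambda>b. {v, b}) bs"
  have nbr: "(v, u) \<in> E" "(u, v) \<in> E" if "u \<in> N" for u
    using assms that by (auto dest: symD)
  have rest: "(x, y) \<in> E" if "x \<in> N - B" "y \<in> N - B" "x \<noteq> y" for x y
  proof (rule ccontr)
    assume "(x, y) \<notin> E"
    then have "{x, y} \<in> M" using that by (auto simp: M)
    then obtain z where "z \<in> B" "z \<in> {x, y}"
      using pick B_def by blast
    then show False using that by auto
  qed
  have "is_clique E (insert v (N - B))" "\<forall>b\<in>B. is_clique E {v, b}"
    using nbr rest BN by (auto simp: is_clique_def)
  then show ?thesis
    using bs BN \<open>card B \<le> card M\<close> by (intro exI[of _ ?Ts]) auto
qed

lemma (in pair_graph) card_nonadjacent_le_holes: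
  assumes W: "W \<subseteq> pverts G" and v: "avoidable (parcs G) W v"
    and M: "M = {{u, w} | u w. u \<in> W \<inter> parcs G `` {v} \<and> w \<in> W \<inter> parcs G `` {v} \<and>
      u \<noteq> w \<and> (u, w) \<notin> parcs G}"
  shows "card M \<le> card {C. hole G C \<and> pverts C \<subseteq> W \<and> v \<in> pverts C}" (is "_ \<le> card ?H")
proof -
  have "\<forall>X\<in>M. \<exists>C. C \<in> ?H \<and> parcs G `` {v} \<inter> pverts C = X"
    using avoidable_hole[OF W v] by (fastforce simp: M)
  from bchoice[OF this]
  obtain f where f: "\<forall>X\<in>M. f X \<in> ?H \<and> parcs G `` {v} \<inter> pverts (f X) = X" ..
  have "inj_on f M"
    by (rule inj_on_inverseI[where g = "\<lambda>C. parcs G `` {v} \<inter> pverts C"]) (simp add: f)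
  moreover have "f ` M \<subseteq> ?H" using f by blast
  moreover have "finite ?H"
    using finite_holes[OF pair_graph_axioms] by (rule rev_finite_subset) auto
  ultimately show ?thesis by (rule card_inj_on_le)
qed

text \<open>
  An avoidable vertex \<open>v\<close> of \<open>W\<close> is put last, and the cliques that cover the edges at \<open>v\<close> are
  appended to a schedule for the other vertices. They may contain vertices from all of \<open>W\<close>, so
  their positions must be at least \<open>card W\<close>. The strict inequality between the lengths
  guarantees this.
\<close>

lemma (in pair_graph) clique_schedule_exists:
  assumes "W \<subseteq> pverts G"
  shows "\<exists>vs Ss. clique_schedule (parcs G) W vs Ss \<and> length vs < length Ss \<and>
    length Ss \<le> length vs + card {C. hole G C \<and> pverts C \<subseteq> W} + 1"
proof -
  have "finite W" using assms pair_finite_verts finite_subset by blast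
  then show ?thesis using assms
  proof (induction W rule: finite_psubset_induct)
    case (psubset W)
    show ?case
    proof (cases "W = {}")
      case True
      then show ?thesis
        by (intro exI[of _ "[]"] exI[of _ "[{}]"]) (auto simp: clique_schedule_def is_clique_def)
    next
      case False
      then obtain v where v: "avoidable (parcs G) W v"
        using avoidable_exists psubset.hyps sym_parcs by metis
      then have vW: "v \<in> W" by (simp add: avoidable_def)
      let ?W = "W - {v}" and ?N = "W \<inter> parcs G `` {v}"
      let ?H = "\<lambda>W. {C. hole G C \<and> pverts C \<subseteq> W}"
      let ?Hv = "{C. hole G C \<and> pverts C \<subseteq> W \<and> v \<in> pverts C}"
      define M where "M = {{u, w} | u w. u \<in> ?N \<and> w \<in> ?N \<and> u \<noteq> w \<and> (u, w) \<notin> parcs G}"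
      obtain vs Ss where IH: "clique_schedule (parcs G) ?W vs Ss" "length vs < length Ss"
        "length Ss \<le> length vs + card (?H ?W) + 1"
        using psubset.IH[of ?W] psubset.prems vW by blast
      have "finite ?N" "\<forall>u\<in>?N. (v, u) \<in> parcs G" using psubset.hyps by simp_all
      from clique_cover_nonadjacent[OF this sym_parcs M_def] obtain Ts where Ts: "Ts \<noteq> []" "length Ts \<le> card M + 1"
        "\<forall>T\<in>set Ts. T \<subseteq> insert v ?N \<and> is_clique (parcs G) T"
        "\<forall>u\<in>?N. \<exists>T\<in>set Ts. v \<in> T \<and> u \<in> T"
        by (elim exE conjE)
      have fin: "finite (?H W)"
        using finite_holes[OF pair_graph_axioms] by (rule rev_finite_subset) auto
      have split: "?H W = ?H ?W \<union> ?Hv" by auto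
      have "card (?H ?W \<union> ?Hv) = card (?H ?W) + card ?Hv"
        by (rule card_Un_disjoint) (auto intro: rev_finite_subset[OF fin])
      then have "card (?H W) = card (?H ?W) + card ?Hv"
        by (simp only: split)
      then have len: "length (Ss @ Ts) \<le> length (vs @ [v]) + card (?H W) + 1"
        using IH Ts card_nonadjacent_le_holes[OF psubset.prems v M_def] by simp
      have vs: "distinct vs" "set vs = ?W"
        using clique_scheduleD(1,2)[OF IH(1)] .
      have "clique_schedule (parcs G) W (vs @ [v]) (Ss @ Ts)"
        unfolding clique_schedule_def
      proof (intro conjI)
        show "distinct (vs @ [v])" "set (vs @ [v]) = W"
          using vs vW by auto
        show "\<forall>S\<in>set (Ss @ Ts). is_clique (parcs G) S"
          using clique_scheduleD(4)[OF IH(1)] Ts(3) by auto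
        show "\<forall>i<length (Ss @ Ts). (Ss @ Ts) ! i \<subseteq> set (take i (vs @ [v]))"
        proof (intro allI impI)
          fix i assume i: "i < length (Ss @ Ts)"
          show "(Ss @ Ts) ! i \<subseteq> set (take i (vs @ [v]))"
          proof (cases "i < length Ss")
            case True
            then have "Ss ! i \<subseteq> set (take i vs)"
              by (rule clique_scheduleD(3)[OF IH(1)])
            then show ?thesis using True by (auto simp: nth_append)
          next
            case False
            then have "(Ss @ Ts) ! i \<in> set Ts"
              using i by (auto simp: nth_append)
            then have "(Ss @ Ts) ! i \<subseteq> W" using Ts vW by auto
            moreover have "set (take i (vs @ [v])) = W"
              using False IH(2) vs vW by auto
            ultimately show ?thesis by simp
          qed
        qed
        show "\<forall>(x, y)\<in>Restr (parcs G) W. \<exists>S\<in>set (Ss @ Ts). x \<in> S \<and> y \<in> S"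
        proof clarify
          fix x y assume xy: "(x, y) \<in> parcs G" "x \<in> W" "y \<in> W"
          then have yx: "(y, x) \<in> parcs G" using sym_parcs by (meson symD)
          consider "x = v" | "y = v" | "(x, y) \<in> Restr (parcs G) ?W"
            using xy by blast
          then show "\<exists>S\<in>set (Ss @ Ts). x \<in> S \<and> y \<in> S"
          proof cases
            case 1
            then show ?thesis using Ts(4) xy by auto
          next
            case 2
            then show ?thesis using Ts(4) xy yx by auto
          next
            case 3
            then show ?thesis using clique_scheduleD(5)[OF IH(1), of x y] by auto
          qed
        qed
      qed
      moreover have "length (vs @ [v]) < length (Ss @ Ts)"
        using IH(2) Ts(1) by (cases Ts) auto
      ultimately show ?thesis using len by blast
    qed
  qed
qed

section \<open>From an elimination ordering to an acyclic digraph\<close>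

text \<open>
  Vertices and new vertices are numbered consecutively by \<open>prey\<close>, and the members of clique \<open>i\<close>
  get the common prey \<open>prey i\<close>. All arcs then increase this number, so the digraph is acyclic. No
  vertex is prey of two cliques, so the competition graph has exactly the edges that the cliques
  cover.
\<close>

lemma (in pair_graph) competition_number_le_schedule:
  assumes sched: "clique_schedule (parcs G) (pverts G) vs Ss"
  shows "competition_number G \<le> length Ss - length vs"
proof -
  let ?n = "length vs" and ?k = "length Ss - length vs"
  note vs = clique_scheduleD(1,2)[OF sched]
    and early = clique_scheduleD(3)[OF sched]
    and clique = clique_scheduleD(4)[OF sched]
  have cover: "\<exists>S\<in>set Ss. x \<in> S \<and> y \<in> S" if "(x, y) \<in> parcs G" for x y
    using clique_scheduleD(5)[OF sched that] that in_arcsD1 in_arcsD2 by blast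
  define prey :: "nat \<Rightarrow> 'a + nat" where
    "prey i = (if i < ?n then Inl (vs ! i) else Inr (i - ?n))" for i
  define A :: "('a + nat) rel" where "A = {(Inl x, prey i) | x i. i < length Ss \<and> x \<in> Ss ! i}"
  define D where "D = \<lparr>pverts = Inl ` pverts G \<union> Inr ` {..<?k}, parcs = A\<rparr>"
  have inj: "prey i = prey j \<Longrightarrow> i = j" for i j
    using vs(1) by (auto simp: prey_def nth_eq_iff_index_eq split: if_splits)
  have sub: "Ss ! i \<subseteq> pverts G" if "i < length Ss" for i
    using early[OF that] set_take_subset[of i vs] vs by blast
  have prey_D: "prey i \<in> pverts D" if "i < length Ss" for i
    using that vs by (auto simp: prey_def D_def)
  have pos: "\<exists>j<i. x = vs ! j \<and> j < ?n" if "i < length Ss" "x \<in> Ss ! i" for i x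
  proof -
    have "x \<in> set (take i vs)" using early[OF that(1)] that(2) by blast
    then show ?thesis by (auto simp: in_set_conv_nth)
  qed
  have src: "\<exists>j<i. Inl x = prey j" if "i < length Ss" "x \<in> Ss ! i" for i x
    using pos[OF that] by (auto simp: prey_def)
  have A_D: "A \<subseteq> pverts D \<times> pverts D"
    using sub prey_D by (auto simp: A_def D_def)
  have less: "inv prey a < inv prey b" if arc: "(a, b) \<in> A" for a b
  proof -
    obtain x i where xi: "a = Inl x" "b = prey i" "i < length Ss" "x \<in> Ss ! i"
      using arc by (auto simp: A_def)
    then obtain j where "j < i" "a = prey j" using src by blast
    moreover have "inj prey" using inj by (auto intro: injI)
    ultimately show ?thesis using xi by simp
  qed
  have "acyclic A"
  proof (rule acyclicI_order)
    \<comment> \<open>the required measure decreases along arcs, whereas the prey number increases\<close>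
    show "length Ss - inv prey b < length Ss - inv prey a" if arc: "(a, b) \<in> A" for a b
    proof -
      obtain i where "b = prey i" "i < length Ss" using arc by (auto simp: A_def)
      moreover have "inj prey" using inj by (auto intro: injI)
      ultimately show ?thesis using less[OF arc] by simp
    qed
  qed
  moreover have "pair_digraph D"
  proof
    show "fst e \<in> pverts D" "snd e \<in> pverts D" if "e \<in> parcs D" for e
      using that A_D by (auto simp: D_def)
    show fin: "finite (pverts D)"
      using pair_finite_verts by (simp add: D_def)
    show "finite (parcs D)"
      using A_D fin finite_subset by (fastforce simp: D_def)
    show "fst e \<noteq> snd e" if "e \<in> parcs D" for e
      using that less[of "fst e" "snd e"] by (auto simp: D_def)
  qed
  moreover have "competition_graph D = add_isolated G ?k"
  proof -
    have "x \<in> pverts D \<and> y \<in> pverts D \<and> x \<noteq> y \<and> (\<exists>z\<in>pverts D. (x, z) \<in> A \<and> (y, z) \<in> A) \<longleftrightarrow>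
      (x, y) \<in> map_prod Inl Inl ` parcs G" (is "?L \<longleftrightarrow> ?R") for x y
    proof
      assume ?L
      then obtain a b i j where ab: "x = Inl a" "y = Inl b" "x \<noteq> y" "prey i = prey j"
        "i < length Ss" "a \<in> Ss ! i" "b \<in> Ss ! j"
        by (auto simp: A_def)
      then have "(a, b) \<in> parcs G"
        using inj[of i j] clique[of "Ss ! i"] by (auto simp: is_clique_def)
      then show ?R using ab by (auto intro: rev_image_eqI)
    next
      assume ?R
      then obtain a b where ab: "x = Inl a" "y = Inl b" "(a, b) \<in> parcs G" by auto
      then obtain i where i: "i < length Ss" "a \<in> Ss ! i" "b \<in> Ss ! i"
        using cover by (metis in_set_conv_nth)
      then have "(x, prey i) \<in> A" "(y, prey i) \<in> A" using ab by (auto simp: A_def)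
      moreover have "a \<noteq> b" using pair_no_loops[OF ab(3)] by simp
      ultimately show ?L using A_D ab by blast
    qed
    then show ?thesis
      by (auto simp: competition_graph_def add_isolated_def D_def)
  qed
  ultimately show ?thesis
    unfolding competition_number_def by (intro Least_le) (auto simp: D_def)
qed

section \<open>The bound\<close>

lemma (in pair_graph) competition_number_le_holes:
  "competition_number G \<le> card {C. hole G C} + 1"
proof -
  have "{C. hole G C \<and> pverts C \<subseteq> pverts G} = {C. hole G C}"
    by (auto simp: hole_def induced_subgraph_def subgraph_def)
  then obtain vs Ss where S: "clique_schedule (parcs G) (pverts G) vs Ss" "length vs < length Ss"
    "length Ss \<le> length vs + card {C. hole G C} + 1"
    using clique_schedule_exists[of "pverts G"] by auto
  then show ?thesis
    using competition_number_le_schedule[of vs Ss] by simp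
qed

theorem theorem1p7:
  fixes G :: "'a pair_pre_digraph" and h :: nat
  assumes "pair_graph G"
    and "card {C. hole G C} = h"
    and "\<And>C\<^sub>1 C\<^sub>2. hole G C\<^sub>1 \<Longrightarrow> hole G C\<^sub>2 \<Longrightarrow> C\<^sub>1 \<noteq> C\<^sub>2 \<Longrightarrow>
           card (edges C\<^sub>1 \<inter> edges C\<^sub>2) \<le> 1"
  shows "competition_number G \<le> h + 1"
  using pair_graph.competition_number_le_holes[OF assms(1)] assms(2) by simp

end
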